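(* Let $n,k\geq 1$ be integers and write $n=p2^q$ with $p$ odd and $q\geq 0$ an integer. Let $H_{2n}^k$ denote the Cartesian product $K_{2n}\square K_{2n}\square\cdots\square K_{2n}$ of $k$ copies of the complete graph $K_{2n}$. Then (1) $H_{2n}^k\in\mathfrak{N}$; (2) $w(H_{2n}^k)=(2n-1)k$; (3) $W(H_{2n}^k)\geq (4n-2-p-q)k$.
   Context: All graphs are finite, undirected, without loops or multiple edges. An edge coloring of a graph $G$ with colors $1,2,\ldots,t$ is an interval $t$-coloring if every color $i\in\{1,\ldots,t\}$ is used on at least one edge, and for every vertex $v$ the colors of the edges incident to $v$ are pairwise distinct and form an interval of consecutive integers. $G$ is interval colorable if it has an interval $t$-coloring for some integer $t\geq 1$; $\mathfrak{N}$ denotes the set of interval colorable graphs. For $G\in\mathfrak{N}$, $w(G)$ and $W(G)$ denote the least and greatest $t$ for which $G$ has an interval $t$-coloring. The Cartesian product $G\square H$ has vertex set $V(G)\times V(H)$, with $(u_1,v_1)$ adjacent to $(u_2,v_2)$ iff either ($u_1=u_2$ and $v_1v_2\in E(H)$) or ($v_1=v_2$ and $u_1u_2\in E(G)$). *)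

theory Defs
  imports "Graph_Theory.Kuratowski"
begin

text \<open>
  A finite simple undirected graph is a \<^locale>\<open>pair_graph\<close>: a finite, loop-free, symmetric
  relation. Each undirected edge is thus represented by two arcs; colorings are therefore
  defined on the unordered pairs, so that both arcs necessarily receive the same color.
\<close>

definition uedges :: "'a pair_pre_digraph \<Rightarrow> 'a set set" where
  "uedges G = {{u, v} | u v. (u, v) \<in> parcs G}"

definition incident_uedges :: "'a pair_pre_digraph \<Rightarrow> 'a \<Rightarrow> 'a set set" where
  "incident_uedges G v = {e \<in> uedges G. v \<in> e}"

text \<open>The interval at an isolated vertex is empty (take \<open>a > b\<close>).\<close>

definition interval_coloring :: "'a pair_pre_digraph \<Rightarrow> nat \<Rightarrow> ('a set \<Rightarrow> nat) \<Rightarrow> bool" where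
  "interval_coloring G t c \<longleftrightarrow>
     c ` uedges G = {1..t} \<and>
     (\<forall>v \<in> pverts G. inj_on c (incident_uedges G v) \<and>
        (\<exists>a b. c ` incident_uedges G v = {a..b}))"

definition has_interval_coloring :: "'a pair_pre_digraph \<Rightarrow> nat \<Rightarrow> bool" where
  "has_interval_coloring G t \<longleftrightarrow> t \<ge> 1 \<and> (\<exists>c. interval_coloring G t c)"

definition interval_colorable :: "'a pair_pre_digraph \<Rightarrow> bool" where
  "interval_colorable G \<longleftrightarrow> (\<exists>t. has_interval_coloring G t)"

text \<open>Both are meaningful only for interval colorable graphs.\<close>

definition min_interval_colors :: "'a pair_pre_digraph \<Rightarrow> nat" where
  "min_interval_colors G = (LEAST t. has_interval_coloring G t)"

definition max_interval_colors :: "'a pair_pre_digraph \<Rightarrow> nat" where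
  "max_interval_colors G = (GREATEST t. has_interval_coloring G t)"

lemma has_interval_coloring_le:
  assumes "pair_graph G" "has_interval_coloring G t"
  shows "t \<le> card (uedges G)"
proof -
  interpret pair_graph G by (rule assms)
  have "uedges G = (\<lambda>(u, v). {u, v}) ` parcs G"
    by (auto simp: uedges_def)
  then have "finite (uedges G)" by simp
  moreover obtain c where "c ` uedges G = {1..t}"
    using assms by (auto simp: has_interval_coloring_def interval_coloring_def)
  ultimately show ?thesis
    by (metis card_atLeastAtMost card_image_le diff_Suc_1)
qed

definition complete_graph :: "nat \<Rightarrow> nat pair_pre_digraph" where
  "complete_graph m = \<lparr>pverts = {..<m}, parcs = {(u, v). u < m \<and> v < m \<and> u \<noteq> v}\<rparr>"

lemma complete_digraph_complete_graph: "complete_digraph m (with_proj (complete_graph m))"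
  by (auto simp: complete_digraph_pair_def complete_graph_def)

definition cart_prod ::
  "'a pair_pre_digraph \<Rightarrow> 'b pair_pre_digraph \<Rightarrow> ('a \<times> 'b) pair_pre_digraph" where
  "cart_prod G H =
     \<lparr>pverts = pverts G \<times> pverts H,
      parcs = {((u1, v1), (u2, v2)).
         u1 \<in> pverts G \<and> u2 \<in> pverts G \<and> v1 \<in> pverts H \<and> v2 \<in> pverts H \<and>
         (u1 = u2 \<and> (v1, v2) \<in> parcs H \<or> v1 = v2 \<and> (u1, u2) \<in> parcs G)}\<rparr>"

definition relabel :: "('a \<Rightarrow> 'b) \<Rightarrow> 'a pair_pre_digraph \<Rightarrow> 'b pair_pre_digraph" where
  "relabel f G = \<lparr>pverts = f ` pverts G, parcs = map_prod f f ` parcs G\<rparr>"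

text \<open>
  The \<open>k\<close>-fold product would change its vertex type with \<open>k\<close>; so the nested tuple
  \<open>(x\<^sub>1, (x\<^sub>2, \<dots>))\<close> is relabelled injectively as the list \<open>[x\<^sub>1, x\<^sub>2, \<dots>]\<close>. The empty product
  is the one-vertex graph, the unit of \<^const>\<open>cart_prod\<close> up to isomorphism.
\<close>

primrec cart_power :: "'a pair_pre_digraph \<Rightarrow> nat \<Rightarrow> 'a list pair_pre_digraph" where
  "cart_power G 0 = \<lparr>pverts = {[]}, parcs = {}\<rparr>"
| "cart_power G (Suc k) = relabel (\<lambda>(x, xs). x # xs) (cart_prod G (cart_power G k))"

lemma cart_power_1:
  assumes "pair_wf_digraph G"
  shows "cart_power G 1 = relabel (\<lambda>x. [x]) G"
proof -
  interpret pair_wf_digraph G by (rule assms)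
  show ?thesis
    by (force simp: relabel_def cart_prod_def image_iff map_prod_def dest: in_arcsD1 in_arcsD2)
qed

lemma pair_graph_complete_graph: "pair_graph (complete_graph m)"
  by (rule pair_graphI_complete[OF complete_digraph_complete_graph])

lemma pair_graph_cart_prod:
  assumes "pair_graph G" "pair_graph H"
  shows "pair_graph (cart_prod G H)"
proof -
  interpret G: pair_graph G by (rule assms)
  interpret H: pair_graph H by (rule assms)
  have "parcs (cart_prod G H) \<subseteq> (pverts G \<times> pverts H) \<times> (pverts G \<times> pverts H)"
    by (auto simp: cart_prod_def)
  then have fin: "finite (parcs (cart_prod G H))"
    by (rule finite_subset) simp
  have "sym (parcs G)" "sym (parcs H)"
    using G.sym_arcs H.sym_arcs by (simp_all add: symmetric_def)
  then have "sym (parcs (cart_prod G H))"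
    by (auto simp: cart_prod_def sym_def)
  with fin show ?thesis
    by unfold_locales
      (auto simp: cart_prod_def symmetric_def dest: G.no_loops' H.no_loops')
qed

lemma pair_graph_relabel:
  assumes "pair_graph G" "inj f"
  shows "pair_graph (relabel f G)"
proof -
  interpret pair_graph G by (rule assms)
  have "sym (parcs G)"
    using sym_arcs by (simp add: symmetric_def)
  then have "sym (parcs (relabel f G))"
    by (force simp: relabel_def sym_def)
  then show ?thesis
    using assms(2)
    by unfold_locales
      (auto simp: relabel_def symmetric_def inj_eq dest: no_loops' in_arcsD1 in_arcsD2)
qed

lemma pair_graph_cart_power:
  assumes "pair_graph G"
  shows "pair_graph (cart_power G k)"
proof (induction k)
  case 0
  show ?case by unfold_locales (auto simp: symmetric_def)
next
  case (Suc k)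
  have "inj (\<lambda>(x :: 'a, xs). x # xs)" by (auto simp: inj_def)
  with Suc assms show ?case
    by (simp add: pair_graph_relabel pair_graph_cart_prod)
qed

end

theory Submission
  imports Defs
begin

text \<open>
  Everything reduces to interval colorings of regular graphs in which the colors at a vertex \<open>v\<close>
  form the interval \<open>{lo v..<lo v + d}\<close>. Reducing such a coloring modulo the degree \<open>d\<close> leaves
  all colors at every vertex distinct, so the least number of colors is \<open>d\<close>. In a product, the
  edges of the first factor are shifted by the lower end in the second factor and those of the
  second factor by the upper end in the first, so the numbers of colors add up. Finally,
  \<open>K\<^sub>2\<^sub>n\<close> has a coloring with \<open>3n - 2\<close> colors, and a coloring of \<open>K\<^sub>m\<close> with \<open>t\<close> colors yields one of
  \<open>K\<^sub>2\<^sub>m\<close> with \<open>t + 2m - 1\<close> colors; iterating \<open>q\<close> times from \<open>K\<^sub>2\<^sub>p\<close> gives \<open>4n - 2 - p - q\<close> colors.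
\<close>

section \<open>Regular interval colorings and the least number of colors\<close>

locale regular_interval_coloring =
  fixes G :: "'a pair_pre_digraph" and d t :: nat
    and f :: "'a \<Rightarrow> 'a \<Rightarrow> nat" and lo :: "'a \<Rightarrow> nat"
  assumes color_sym: "(u, v) \<in> parcs G \<Longrightarrow> f u v = f v u"
    and color_bij: "v \<in> pverts G \<Longrightarrow> bij_betw (f v) (parcs G `` {v}) {lo v..<lo v + d}"
    and lo_ge: "v \<in> pverts G \<Longrightarrow> 1 \<le> lo v"
    and hi_le: "v \<in> pverts G \<Longrightarrow> lo v + d \<le> Suc t"
    and ex_lo: "\<exists>v \<in> pverts G. lo v = 1"
    and ex_hi: "\<exists>v \<in> pverts G. lo v + d = Suc t"
    and covering: "\<lbrakk>1 \<le> c; c \<le> t\<rbrakk> \<Longrightarrow> \<exists>v \<in> pverts G. lo v \<le> c \<and> c < lo v + d"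

lemma incident_uedges_eq:
  assumes "pair_graph G"
  shows "incident_uedges G v = (\<lambda>u. {v, u}) ` (parcs G `` {v})"
proof -
  interpret pair_graph G by (rule assms)
  have "sym (parcs G)" using sym_arcs by (simp add: symmetric_def)
  then show ?thesis
    by (auto simp: incident_uedges_def uedges_def image_iff dest: symD)
qed

lemma card_incident_uedges:
  "pair_graph G \<Longrightarrow> card (incident_uedges G v) = card (parcs G `` {v})"
  by (simp add: incident_uedges_eq card_image inj_on_def doubleton_eq_iff)

lemma card_neighbours_le_colors:
  assumes "pair_graph G" "has_interval_coloring G t" "v \<in> pverts G"
  shows "card (parcs G `` {v}) \<le> t"
proof -
  obtain c where c: "c ` uedges G = {1..t}" "inj_on c (incident_uedges G v)"
    using assms by (auto simp: has_interval_coloring_def interval_coloring_def)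
  have "c ` incident_uedges G v \<subseteq> {1..t}"
    using c(1) by (auto simp: incident_uedges_def)
  then have "card (incident_uedges G v) \<le> card {1..t}"
    using c(2) by (intro card_inj_on_le) auto
  then show ?thesis using assms by (simp add: card_incident_uedges)
qed

context regular_interval_coloring
begin

lemma degree_le: "d \<le> t"
  using ex_lo hi_le by fastforce

lemma card_neighbours:
  assumes "v \<in> pverts G" shows "card (parcs G `` {v}) = d"
  using bij_betw_same_card[OF color_bij[OF assms]] by simp

lemma has_interval_coloring:
  assumes "pair_graph G" "1 \<le> t"
  shows "has_interval_coloring G t"
proof -
  interpret pair_graph G by (rule assms)
  \<comment> \<open>\<open>f\<close> lives on ordered pairs but a coloring on unordered ones; by
    \<open>color_sym\<close> the choice does not depend on the orientation.\<close>
  define c where "c e = (SOME i. \<exists>u v. (u, v) \<in> parcs G \<and> e = {u, v} \<and> i = f u v)" for e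
  have c: "c {u, v} = f u v" if "(u, v) \<in> parcs G" for u v
    unfolding c_def using that by (rule_tac someI2) (auto simp: doubleton_eq_iff color_sym)
  have c_incident: "c ` incident_uedges G v = {lo v..<lo v + d}" if "v \<in> pverts G" for v
    using color_bij[OF that] by (force simp: incident_uedges_eq assms image_image c bij_betw_def)
  have uedges: "uedges G = (\<Union>v \<in> pverts G. incident_uedges G v)"
    by (auto simp: uedges_def incident_uedges_def dest: in_arcsD1)
  have "c ` uedges G = (\<Union>v \<in> pverts G. {lo v..<lo v + d})"
    by (simp add: uedges image_UN c_incident)
  also have "\<dots> = {1..t}"
  proof (intro equalityI subsetI)
    fix i assume "i \<in> (\<Union>v \<in> pverts G. {lo v..<lo v + d})"
    then obtain v where "v \<in> pverts G" "lo v \<le> i" "i < lo v + d" by auto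
    then show "i \<in> {1..t}" using lo_ge[of v] hi_le[of v] by auto
  qed (use covering in auto)
  finally have "c ` uedges G = {1..t}" .
  \<comment> \<open>By counting: the \<open>d\<close> edges at \<open>v\<close> receive an interval
    of \<open>d\<close> colors.\<close>
  moreover have "inj_on c (incident_uedges G v)" if "v \<in> pverts G" for v
  proof (rule eq_card_imp_inj_on)
    have "finite (parcs G)" by simp
    then show "finite (incident_uedges G v)" by (simp add: incident_uedges_eq assms finite_Image)
    show "card (c ` incident_uedges G v) = card (incident_uedges G v)"
      using that by (simp only: c_incident card_incident_uedges assms card_neighbours) simp
  qed
  moreover have "\<exists>a b. c ` incident_uedges G v = {a..b}" if "v \<in> pverts G" for v
  proof (cases d)
    case 0
    then show ?thesis using c_incident[OF that] by (intro exI[of _ 1] exI[of _ 0]) simp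
  next
    case (Suc d')
    then show ?thesis using c_incident[OF that]
      by (intro exI[of _ "lo v"] exI[of _ "lo v + d'"]) (simp add: atLeastLessThanSuc_atLeastAtMost)
  qed
  ultimately show ?thesis
    using assms(2) unfolding has_interval_coloring_def interval_coloring_def by blast
qed

text \<open>Any \<open>d\<close> consecutive integers form a complete residue system modulo
  \<open>d\<close>, so after reduction every vertex sees exactly the colors 1 to
  \<open>d\<close>.\<close>

lemma reduce_mod_degree:
  "regular_interval_coloring G d d (\<lambda>u v. Suc (f u v mod d)) (\<lambda>_. 1)"
proof
  show "Suc (f u v mod d) = Suc (f v u mod d)" if "(u, v) \<in> parcs G" for u v
    using color_sym[OF that] by simp
next
  fix v assume v: "v \<in> pverts G"
  have mod_inj: "inj_on (\<lambda>i. Suc (i mod d)) {lo v..<lo v + d}"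
  proof (rule inj_onI)
    fix i j assume ij: "i \<in> {lo v..<lo v + d}" "j \<in> {lo v..<lo v + d}"
      and eq: "Suc (i mod d) = Suc (j mod d)"
    \<comment> \<open>Over the integers, \<open>d\<close> divides a difference of absolute value
      below \<open>d\<close>, which must then be 0.\<close>
    then have "int i mod int d = int j mod int d" by (simp flip: of_nat_mod)
    then have "int d dvd int i - int j" by (simp add: mod_eq_dvd_iff)
    moreover have "\<bar>int i - int j\<bar> < int d" using ij by auto
    ultimately show "i = j" using zdvd_not_zless[of "\<bar>int i - int j\<bar>" "int d"] by auto
  qed
  have "(\<lambda>i. Suc (i mod d)) ` {lo v..<lo v + d} = {1..<1 + d}"
  proof (rule card_subset_eq)
    show "(\<lambda>i. Suc (i mod d)) ` {lo v..<lo v + d} \<subseteq> {1..<1 + d}" by auto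
  qed (use mod_inj in \<open>simp_all add: card_image\<close>)
  then have "bij_betw ((\<lambda>i. Suc (i mod d)) \<circ> f v) (parcs G `` {v}) {1..<1 + d}"
    using mod_inj by (intro bij_betw_trans[OF color_bij[OF v]]) (simp add: bij_betw_def)
  then show "bij_betw (\<lambda>u. Suc (f v u mod d)) (parcs G `` {v}) {1..<1 + d}"
    by (simp add: o_def)
qed (use ex_lo in auto)

lemma min_interval_colors_eq:
  assumes "pair_graph G" "1 \<le> d"
  shows "min_interval_colors G = d"
  unfolding min_interval_colors_def
proof (rule Least_equality)
  show "has_interval_coloring G d"
    using assms by (intro regular_interval_coloring.has_interval_coloring[OF reduce_mod_degree])
  show "d \<le> s" if "has_interval_coloring G s" for s
    using card_neighbours_le_colors[OF assms(1) that] card_neighbours ex_lo by auto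
qed

text \<open>Needed because \<open>cart_power\<close> recodes the pairs of a product as
  lists.\<close>

lemma relabelled:
  assumes g: "inj g"
  shows "regular_interval_coloring (relabel g G) d t
    (\<lambda>u v. f (inv g u) (inv g v)) (\<lambda>v. lo (inv g v))"
proof
  fix v assume "v \<in> pverts (relabel g G)"
  then obtain w where w: "w \<in> pverts G" "v = g w" by (auto simp: relabel_def)
  have "parcs (relabel g G) `` {v} = g ` (parcs G `` {w})"
    using g by (force simp: relabel_def w inj_eq)
  then have "bij_betw (inv g) (parcs (relabel g G) `` {v}) (parcs G `` {w})"
    using g by (auto simp: bij_betw_def inj_on_def image_image)
  from bij_betw_trans[OF this color_bij[OF w(1)]]
  show "bij_betw (\<lambda>u. f (inv g v) (inv g u)) (parcs (relabel g G) `` {v})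
      {lo (inv g v)..<lo (inv g v) + d}"
    using g by (simp add: w o_def)
qed (use g ex_lo ex_hi covering lo_ge in \<open>auto simp: relabel_def hi_le intro: color_sym\<close>)

end

section \<open>Cartesian products and powers\<close>

text \<open>The new ends are variables tied by equations, so that ends written with truncated
  subtraction can be matched and checked separately.\<close>

lemma bij_betw_add_interval:
  fixes a b s :: nat
  assumes "a' = a + s" "b' = b + s"
  shows "bij_betw (\<lambda>i. i + s) {a..<b} {a'..<b'}"
  using assms by (simp add: bij_betw_def image_add_atLeastLessThan')

text \<open>Each shift depends only on the coordinate that the edge keeps, hence agrees at both of
  its ends. At \<open>(x, u)\<close> the first-factor edges fill \<open>d\<close> colors from
  \<open>lo x + lo' u - 1\<close> on, and the second-factor edges the next \<open>d'\<close>. The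
  \<open>- 1\<close> keeps 1 as the lowest color.\<close>

lemma regular_interval_coloring_cart_prod:
  assumes "regular_interval_coloring G d t f lo" "regular_interval_coloring H d' t' f' lo'"
    and "pair_graph G" "pair_graph H"
  shows "regular_interval_coloring (cart_prod G H) (d + d') (t + t')
    (\<lambda>(x, u) (y, v). if x = y then f' u v + lo x + d - 1 else f x y + lo' u - 1)
    (\<lambda>(x, u). lo x + lo' u - 1)" (is "regular_interval_coloring ?P _ _ ?f ?lo")
proof -
  interpret G: regular_interval_coloring G d t f lo by (rule assms)
  interpret H: regular_interval_coloring H d' t' f' lo' by (rule assms)
  interpret Gg: pair_graph G by (rule assms)
  interpret Hg: pair_graph H by (rule assms)
  have verts: "pverts ?P = pverts G \<times> pverts H" by (simp add: cart_prod_def)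
  show ?thesis
  proof
    fix a b assume "(a, b) \<in> parcs ?P"
    then show "?f a b = ?f b a"
      by (auto simp: cart_prod_def dest: G.color_sym H.color_sym)
  next
    fix a assume "a \<in> pverts ?P"
    then obtain x u where a: "a = (x, u)" and x: "x \<in> pverts G" and u: "u \<in> pverts H"
      by (auto simp: verts)
    have nbrs: "parcs ?P `` {a} = (\<lambda>y. (y, u)) ` (parcs G `` {x}) \<union> Pair x ` (parcs H `` {u})"
      using x u by (auto simp: a cart_prod_def dest: Gg.in_arcsD2 Hg.in_arcsD2)
    have "bij_betw (?f a \<circ> (\<lambda>y. (y, u))) (parcs G `` {x}) {?lo a..<?lo a + d}"
    proof -
      have shift: "bij_betw (\<lambda>i. i + (lo' u - 1)) {lo x..<lo x + d} {?lo a..<?lo a + d}"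
        using H.lo_ge[OF u] by (intro bij_betw_add_interval) (auto simp: a)
      have "bij_betw (\<lambda>y. f x y + (lo' u - 1)) (parcs G `` {x}) {?lo a..<?lo a + d}"
        using bij_betw_trans[OF G.color_bij[OF x] shift] by (simp add: o_def)
      \<comment> \<open>Without loops a neighbour \<open>y\<close> differs from \<open>x\<close>, so
        \<open>?f\<close> takes its second branch; \<open>lo' u\<close> being positive makes the two
        placements of \<open>- 1\<close> equal.\<close>
      then show ?thesis
        using H.lo_ge[OF u] by (subst bij_betw_cong) (auto simp: a dest: Gg.no_loops')
    qed
    then have 1: "bij_betw (?f a) ((\<lambda>y. (y, u)) ` (parcs G `` {x})) {?lo a..<?lo a + d}"
      by (subst (asm) bij_betw_comp_iff[symmetric, where A' = "(\<lambda>y. (y, u)) ` (parcs G `` {x})"])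
        (auto simp: bij_betw_def inj_on_def)
    have "bij_betw (?f a \<circ> Pair x) (parcs H `` {u}) {?lo a + d..<?lo a + (d + d')}"
    proof -
      have shift: "bij_betw (\<lambda>i. i + (lo x + d - 1)) {lo' u..<lo' u + d'}
          {?lo a + d..<?lo a + (d + d')}"
        using G.lo_ge[OF x] H.lo_ge[OF u] by (intro bij_betw_add_interval) (auto simp: a)
      have "bij_betw (\<lambda>y. f' u y + (lo x + d - 1)) (parcs H `` {u}) {?lo a + d..<?lo a + (d + d')}"
        using bij_betw_trans[OF H.color_bij[OF u] shift] by (simp add: o_def)
      then show ?thesis
        using G.lo_ge[OF x] by (subst bij_betw_cong) (auto simp: a)
    qed
    then have 2: "bij_betw (?f a) (Pair x ` (parcs H `` {u})) {?lo a + d..<?lo a + (d + d')}"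
      by (subst (asm) bij_betw_comp_iff[symmetric, where A' = "Pair x ` (parcs H `` {u})"])
        (auto simp: bij_betw_def inj_on_def)
    have "{?lo a..<?lo a + (d + d')} = {?lo a..<?lo a + d} \<union> {?lo a + d..<?lo a + (d + d')}"
      by auto
    then show "bij_betw (?f a) (parcs ?P `` {a}) {?lo a..<?lo a + (d + d')}"
      unfolding nbrs using bij_betw_combine[OF 1 2] by auto
  next
    fix a assume "a \<in> pverts ?P"
    then obtain x u where a: "a = (x, u)" "x \<in> pverts G" "u \<in> pverts H"
      by (auto simp: verts)
    show "1 \<le> ?lo a" "?lo a + (d + d') \<le> Suc (t + t')"
      using G.lo_ge[OF a(2)] H.lo_ge[OF a(3)] G.hi_le[OF a(2)] H.hi_le[OF a(3)]
      by (auto simp: a(1))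
  next
    show "\<exists>a \<in> pverts ?P. ?lo a = 1"
      using G.ex_lo H.ex_lo by (force simp: verts)
  next
    obtain x u where xu: "x \<in> pverts G" "lo x + d = Suc t" "u \<in> pverts H" "lo' u + d' = Suc t'"
      using G.ex_hi H.ex_hi by blast
    then show "\<exists>a \<in> pverts ?P. ?lo a + (d + d') = Suc (t + t')"
      using G.lo_ge[OF xu(1)] H.lo_ge[OF xu(3)] by (intro bexI[of _ "(x, u)"]) (auto simp: verts)
  next
    fix c assume c: "1 \<le> c" "c \<le> t + t'"
    \<comment> \<open>Up to \<open>t\<close>, a lowest vertex of \<open>H\<close> leaves the colors
      of \<open>G\<close> unshifted; beyond \<open>t\<close>, a highest vertex of \<open>G\<close>
      shifts those of \<open>H\<close> by exactly \<open>t\<close>.\<close>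
    show "\<exists>a \<in> pverts ?P. ?lo a \<le> c \<and> c < ?lo a + (d + d')"
    proof (cases "c \<le> t")
      case True
      then obtain x u where "x \<in> pverts G" "lo x \<le> c" "c < lo x + d" "u \<in> pverts H" "lo' u = 1"
        using G.covering c H.ex_lo by meson
      then show ?thesis by (intro bexI[of _ "(x, u)"]) (auto simp: verts)
    next
      case False
      then have "1 \<le> c - t" "c - t \<le> t'" using c by auto
      then obtain x u where "x \<in> pverts G" "lo x + d = Suc t"
        "u \<in> pverts H" "lo' u \<le> c - t" "c - t < lo' u + d'"
        using G.ex_hi H.covering by meson
      then show ?thesis
        using False G.lo_ge[of x] H.lo_ge[of u] by (intro bexI[of _ "(x, u)"]) (auto simp: verts)
    qed
  qed
qed

lemma regular_interval_coloring_cart_power: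
  assumes "regular_interval_coloring G d t f lo" "pair_graph G"
  shows "\<exists>g l. regular_interval_coloring (cart_power G k) (d * k) (t * k) g l"
proof (induction k)
  case 0
  \<comment> \<open>The single vertex has an empty interval; the lower end 1 satisfies both end
    conditions, as \<open>1 + 0 = Suc 0\<close>.\<close>
  have "regular_interval_coloring (cart_power G 0) 0 0 (\<lambda>_ _. 0) (\<lambda>_. 1)"
    by unfold_locales (auto simp: bij_betw_def)
  then show ?case by auto
next
  case (Suc k)
  then obtain g l where "regular_interval_coloring (cart_power G k) (d * k) (t * k) g l" by blast
  from regular_interval_coloring.relabelled[OF regular_interval_coloring_cart_prod
      [OF assms(1) this assms(2) pair_graph_cart_power[OF assms(2)]], of "\<lambda>(x, xs). x # xs"]
  show ?case by (auto simp: inj_def)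
qed

section \<open>Colorings of complete graphs\<close>

text \<open>
  By counting, it suffices that the colors at a vertex of \<open>K\<^sub>m\<close> exhaust an interval of length \<open>m - 1\<close>.
\<close>

lemma regular_interval_coloring_complete_graphI:
  assumes "\<And>u v. \<lbrakk>u < m; v < m; u \<noteq> v\<rbrakk> \<Longrightarrow> f u v = f v u"
    and onto: "\<And>v i. \<lbrakk>v < m; lo v \<le> i; i < lo v + (m - 1)\<rbrakk> \<Longrightarrow> \<exists>u<m. u \<noteq> v \<and> f v u = i"
    and "\<And>v. v < m \<Longrightarrow> 1 \<le> lo v \<and> lo v + (m - 1) \<le> Suc t"
    and "\<exists>v<m. lo v = 1" "\<exists>v<m. lo v + (m - 1) = Suc t"
    and "\<And>c. \<lbrakk>1 \<le> c; c \<le> t\<rbrakk> \<Longrightarrow> \<exists>v<m. lo v \<le> c \<and> c < lo v + (m - 1)"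
  shows "regular_interval_coloring (complete_graph m) (m - 1) t f lo"
proof
  fix v assume "v \<in> pverts (complete_graph m)"
  then have v: "v < m" by (simp add: complete_graph_def)
  define N where "N = parcs (complete_graph m) `` {v}"
  have N: "N = {..<m} - {v}" using v by (auto simp: N_def complete_graph_def)
  have sub: "{lo v..<lo v + (m - 1)} \<subseteq> f v ` N" using onto[OF v] by (fastforce simp: N)
  have card: "card N = m - 1" using v by (simp add: N)
  have "f v ` N = {lo v..<lo v + (m - 1)}"
    using card_image_le[of N "f v"] card by (intro card_seteq[symmetric] sub) (auto simp: N)
  then show "bij_betw (f v) (parcs (complete_graph m) `` {v}) {lo v..<lo v + (m - 1)}"
    unfolding bij_betw_def N_def[symmetric] using card
    by (auto intro!: eq_card_imp_inj_on simp: N)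
qed (use assms in \<open>auto simp: complete_graph_def Bex_def\<close>)

text \<open>
  The vertex \<open>2n - 1\<close> takes over the color \<open>n + i\<close> that the rule for even sums would give to the
  missing loop at \<open>i\<close>.
\<close>

lemma complete_graph_even_coloring:
  assumes "1 \<le> n"
  shows "\<exists>f lo. regular_interval_coloring (complete_graph (2 * n)) (2 * n - 1) (3 * n - 2) f lo"
proof -
  define f where "f i j =
    (if i = 2 * n - 1 then n + j else if j = 2 * n - 1 then n + i
     else if even (i + j) then n + (i + j) div 2 else (i + j + 1) div 2)" for i j :: nat
  have "regular_interval_coloring (complete_graph (2 * n)) (2 * n - 1) (3 * n - 2) f
    (\<lambda>i. i div 2 + 1)"
  proof (rule regular_interval_coloring_complete_graphI)
    fix v i assume v: "v < 2 * n" and i: "v div 2 + 1 \<le> i" "i < v div 2 + 1 + (2 * n - 1)"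
    define a where "a = v div 2"
    consider "v = 2 * n - 1" | "v = 2 * a" | "v = 2 * a + 1" "v \<noteq> 2 * n - 1"
      unfolding a_def by fastforce
    then show "\<exists>u<2 * n. u \<noteq> v \<and> f v u = i"
    proof cases
      case 1
      with i assms show ?thesis by (intro exI[of _ "i - n"]) (auto simp: f_def)
    next
      case 2
      \<comment> \<open>Odd \<open>u\<close> below \<open>2 * n - 1\<close> give the colors from
        \<open>a + 1\<close> to \<open>n + a - 1\<close>, even \<open>u\<close> those from
        \<open>n + a\<close> to \<open>2 * n + a - 1\<close> except \<open>n + v\<close>, which the
        edge to \<open>2 * n - 1\<close> supplies.\<close>
      consider "i < n + a" | "i = n + v" | "n + a \<le> i" "i \<noteq> n + v" by linarith
      then show ?thesis
      proof cases
        case 1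
        with 2 i v show ?thesis
          by (intro exI[of _ "2 * (i - a - 1) + 1"]) (auto simp: f_def, presburger)
      next
        case 2
        with \<open>v = 2 * a\<close> i v show ?thesis
          by (intro exI[of _ "2 * n - 1"]) (auto simp: f_def)
      next
        case 3
        with 2 i v show ?thesis
          by (intro exI[of _ "2 * (i - n - a)"]) (auto simp: f_def)
      qed
    next
      case 3
      \<comment> \<open>Now the even \<open>u\<close> give the colors from \<open>a + 1\<close> to
        \<open>n + a\<close>, and the odd ones the rest, again except \<open>n + v\<close>.\<close>
      consider "i \<le> n + a" | "i = n + v" | "n + a < i" "i \<noteq> n + v" by linarith
      then show ?thesis
      proof cases
        case 1
        with 3 i v show ?thesis
          by (intro exI[of _ "2 * (i - a - 1)"]) (auto simp: f_def, presburger)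
      next
        case 2
        with 3 i v show ?thesis
          by (intro exI[of _ "2 * n - 1"]) (auto simp: f_def)
      next
        case 3
        with \<open>v = 2 * a + 1\<close> \<open>v \<noteq> 2 * n - 1\<close> i v show ?thesis
          by (intro exI[of _ "2 * (i - n - a - 1) + 1"]) (auto simp: f_def)
      qed
    qed
  next
    show "\<exists>v<2 * n. v div 2 + 1 = 1" using assms by (intro exI[of _ 0]) auto
    show "\<exists>v<2 * n. v div 2 + 1 + (2 * n - 1) = Suc (3 * n - 2)"
      using assms by (intro exI[of _ "2 * n - 1"]) auto
    \<comment> \<open>Two vertices suffice: 0 sees the colors 1 to \<open>2 * n - 1\<close>, and
      \<open>2 * n - 1\<close> sees \<open>n\<close> to \<open>3 * n - 2\<close>.\<close>
    show "\<exists>v<2 * n. v div 2 + 1 \<le> c \<and> c < v div 2 + 1 + (2 * n - 1)"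
      if "1 \<le> c" "c \<le> 3 * n - 2" for c
    proof (cases "c < 2 * n")
      case True
      then show ?thesis using that by (intro exI[of _ 0]) auto
    next
      case False
      then show ?thesis using that by (intro exI[of _ "2 * n - 1"]) auto
    qed
  qed (auto simp: f_def add.commute)
  then show ?thesis by blast
qed

text \<open>Take two copies of \<open>K_m\<close> with twins \<open>v\<close> and
  \<open>v + m\<close>. The coloring \<open>f\<close> is used unshifted in the lower copy, shifted
  by \<open>m\<close> between non-twins of different copies, and by \<open>2 * m - 1\<close> in the
  upper copy. The twin edge gets \<open>lo v + (m - 1)\<close>: at \<open>v\<close> it fills the gap
  between the unshifted block and the one shifted by \<open>m\<close>; at \<open>v + m\<close> it
  comes just before the two shifted blocks.\<close>

lemma complete_graph_double_coloring:
  assumes "regular_interval_coloring (complete_graph m) (m - 1) t f lo" "1 \<le> m"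
  shows "\<exists>g l. regular_interval_coloring (complete_graph (2 * m)) (2 * m - 1) (t + 2 * m - 1) g l"
proof -
  interpret regular_interval_coloring "complete_graph m" "m - 1" t f lo by (rule assms)
  have sym: "f u v = f v u" if "u < m" "v < m" "u \<noteq> v" for u v
    using color_sym that by (simp add: complete_graph_def)
  have onto: "\<exists>u<m. u \<noteq> v \<and> f v u = i" if "v < m" "lo v \<le> i" "i < lo v + (m - 1)" for v i
  proof -
    have "i \<in> f v ` (parcs (complete_graph m) `` {v})"
      using color_bij[of v] that by (simp add: bij_betw_def complete_graph_def)
    then show ?thesis by (auto simp: complete_graph_def)
  qed
  define g where "g x y =
    (if x mod m = y mod m then lo (x mod m) + (m - 1) else f (x mod m) (y mod m) +
      (if x < m \<and> y < m then 0 else if m \<le> x \<and> m \<le> y then 2 * m - 1 else m))" for x y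
  define l where "l x = (if x < m then lo x else lo (x - m) + (m - 1))" for x
  have upper: "x mod m = x - m" if "m \<le> x" "x < 2 * m" for x
    using that by (simp add: le_mod_geq)
  have "regular_interval_coloring (complete_graph (2 * m)) (2 * m - 1) (t + 2 * m - 1) g l"
  proof (rule regular_interval_coloring_complete_graphI)
    show "g u v = g v u" if "u < 2 * m" "v < 2 * m" "u \<noteq> v" for u v
      using sym[of "u mod m" "v mod m"] assms(2) by (auto simp: g_def)
  next
    fix x i assume x: "x < 2 * m" and i: "l x \<le> i" "i < l x + (2 * m - 1)"
    define v where "v = x mod m"
    have v: "v < m" using assms(2) by (simp add: v_def)
    show "\<exists>y<2 * m. y \<noteq> x \<and> g x y = i"
    proof (cases "x < m")
      case True
      then have xv: "x = v" by (simp add: v_def)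
      consider "i < lo v + (m - 1)" | "i = lo v + (m - 1)" | "lo v + m \<le> i" by linarith
      then show ?thesis
      proof cases
        case 1
        then obtain u where "u < m" "u \<noteq> v" "f v u = i"
          using onto[of v i] v i by (auto simp: l_def xv)
        then show ?thesis using v by (intro exI[of _ u]) (auto simp: g_def xv)
      next
        case 2
        then show ?thesis using v by (intro exI[of _ "v + m"]) (auto simp: g_def xv)
      next
        case 3
        moreover have "i < lo v + 2 * m - 1" using i v by (simp add: l_def xv)
        ultimately have "lo v \<le> i - m" "i - m < lo v + (m - 1)" by linarith+
        then obtain u where "u < m" "u \<noteq> v" "f v u = i - m"
          using onto v by blast
        then show ?thesis using v 3 by (intro exI[of _ "u + m"]) (auto simp: g_def xv)
      qed
    next
      case False
      then have xv: "x = v + m" using x by (simp add: v_def upper)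
      have "i \<ge> lo v + (m - 1)" using i by (simp add: l_def xv)
      then consider "i = lo v + (m - 1)"
        | "lo v + m \<le> i" "i < lo v + m + (m - 1)" | "lo v + m + (m - 1) \<le> i" by linarith
      then show ?thesis
      proof cases
        case 1
        then show ?thesis using v by (intro exI[of _ v]) (auto simp: g_def xv)
      next
        case 2
        then have "lo v \<le> i - m" "i - m < lo v + (m - 1)" by linarith+
        then obtain u where "u < m" "u \<noteq> v" "f v u = i - m"
          using onto v by blast
        then show ?thesis using v 2 by (intro exI[of _ u]) (auto simp: g_def xv)
      next
        case 3
        moreover have "i < lo v + (m - 1) + (2 * m - 1)" using i by (simp add: l_def xv)
        ultimately have "lo v \<le> i - (2 * m - 1)" "i - (2 * m - 1) < lo v + (m - 1)"
          using v by linarith+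
        then obtain u where "u < m" "u \<noteq> v" "f v u = i - (2 * m - 1)"
          using onto v by blast
        then show ?thesis using v 3 by (intro exI[of _ "u + m"]) (auto simp: g_def xv)
      qed
    qed
  next
    fix x assume x: "x < 2 * m"
    define v where "v = x mod m"
    have v: "v \<in> pverts (complete_graph m)" using assms(2) by (simp add: v_def complete_graph_def)
    have "l x \<in> {lo v, lo v + (m - 1)}" using x by (auto simp: l_def v_def upper)
    then show "1 \<le> l x \<and> l x + (2 * m - 1) \<le> Suc (t + 2 * m - 1)"
      using lo_ge[OF v] hi_le[OF v] assms(2) by auto
  next
    obtain v where v: "v < m" "lo v = 1" using ex_lo by (auto simp: complete_graph_def)
    then show "\<exists>x<2 * m. l x = 1" by (intro exI[of _ v]) (auto simp: l_def)
  next
    \<comment> \<open>The twin of a highest vertex has lower end \<open>t + 1\<close>: it attains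
      the top color \<open>t + 2 * m - 1\<close> and sees every color above
      \<open>t\<close>.\<close>
    obtain v where v: "v < m" "lo v + (m - 1) = Suc t"
      using ex_hi by (auto simp: complete_graph_def)
    then show "\<exists>x<2 * m. l x + (2 * m - 1) = Suc (t + 2 * m - 1)"
      by (intro exI[of _ "v + m"]) (auto simp: l_def)
    fix c assume c: "1 \<le> c" "c \<le> t + 2 * m - 1"
    show "\<exists>x<2 * m. l x \<le> c \<and> c < l x + (2 * m - 1)"
    proof (cases "c \<le> t")
      case True
      then obtain u where "u < m" "lo u \<le> c" "c < lo u + (m - 1)"
        using covering[of c] c by (auto simp: complete_graph_def)
      then show ?thesis by (intro exI[of _ u]) (auto simp: l_def)
    next
      case False
      then show ?thesis using v c by (intro exI[of _ "v + m"]) (auto simp: l_def)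
    qed
  qed
  then show ?thesis by blast
qed

text \<open>The induction starts from \<open>3 * p - 2 = 4 * p - 2 - p\<close>. Doubling
  \<open>n = p * 2 ^ q\<close> raises \<open>4 * n - 2 - p - q\<close> by \<open>4 * n - 1\<close>,
  which is the gain \<open>2 * m - 1\<close> for \<open>m = 2 * n\<close>. The additive form of the
  equation avoids truncated subtraction.\<close>

lemma complete_graph_coloring:
  assumes "1 \<le> p"
  shows "\<exists>t f lo. t + 2 + p + q = 4 * (p * 2 ^ q) \<and>
    regular_interval_coloring (complete_graph (2 * (p * 2 ^ q))) (2 * (p * 2 ^ q) - 1) t f lo"
proof (induction q)
  case 0
  show ?case
    using complete_graph_even_coloring[OF assms] assms by (intro exI[of _ "3 * p - 2"]) auto
next
  case (Suc q)
  define m where "m = 2 * (p * 2 ^ q)"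
  have m: "2 * (p * 2 ^ Suc q) = 2 * m" "1 \<le> m" using assms by (auto simp: m_def)
  from Suc obtain t f lo where t: "t + 2 + p + q = 2 * m"
    and "regular_interval_coloring (complete_graph m) (m - 1) t f lo"
    by (auto simp: m_def)
  then obtain g l where
    "regular_interval_coloring (complete_graph (2 * m)) (2 * m - 1) (t + 2 * m - 1) g l"
    using complete_graph_double_coloring m by blast
  moreover have "t + 2 * m - 1 + 2 + p + Suc q = 4 * (p * 2 ^ Suc q)"
    using t m by (simp add: m_def)
  ultimately show ?case unfolding m by blast
qed

section \<open>Least and greatest numbers of colors of the power\<close>

theorem theorem8:
  fixes n k p q :: nat
  assumes "n \<ge> 1" and "k \<ge> 1" and "n = p * 2 ^ q" and "odd p"
  defines "H \<equiv> cart_power (complete_graph (2 * n)) k"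
  shows "interval_colorable H
    \<and> min_interval_colors H = (2 * n - 1) * k
    \<and> int (max_interval_colors H) \<ge> (4 * int n - 2 - int p - int q) * int k"
proof -
  have "1 \<le> p" using \<open>odd p\<close> by (cases p) auto
  then obtain t f lo where t: "t + 2 + p + q = 4 * n"
    and f: "regular_interval_coloring (complete_graph (2 * n)) (2 * n - 1) t f lo"
    using complete_graph_coloring[of p q] assms(3) by auto
  have graph: "pair_graph H"
    unfolding H_def by (intro pair_graph_cart_power pair_graph_complete_graph)
  obtain g l where "regular_interval_coloring H ((2 * n - 1) * k) (t * k) g l"
    using regular_interval_coloring_cart_power[OF f pair_graph_complete_graph] H_def by blast
  then interpret regular_interval_coloring H "(2 * n - 1) * k" "t * k" g l .
  have degree: "1 \<le> (2 * n - 1) * k" using mult_le_mono[of 1 "2 * n - 1" 1 k] assms(1,2) by simp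
  then have color: "has_interval_coloring H (t * k)"
    using degree_le by (intro has_interval_coloring graph) simp
  \<comment> \<open>\<open>GREATEST\<close> bounds its witnesses only when these are bounded; the
    number of edges is such a bound.\<close>
  then have "t * k \<le> max_interval_colors H"
    unfolding max_interval_colors_def
    by (rule Greatest_le_nat) (use has_interval_coloring_le[OF graph] in blast)
  moreover have "4 * int n - 2 - int p - int q = int t" using t by linarith
  ultimately have "int (max_interval_colors H) \<ge> (4 * int n - 2 - int p - int q) * int k"
    by (metis of_nat_le_iff of_nat_mult)
  then show ?thesis
    using color min_interval_colors_eq[OF graph degree] by (auto simp: interval_colorable_def)
qed

end
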